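(* Let $p$ be a prime, let $n,m$ be positive integers with $m > n/2$, and let $V$ and $W$ be elementary abelian $p$-groups (written additively) of orders $p^n$ and $p^m$ respectively. Let $\alpha_1, \alpha_2 : V \times V \rightarrow W$ be generalized nonsingular maps. Then $G(\alpha_1) \cong G(\alpha_2)$ if and only if $\alpha_1$ and $\alpha_2$ are either isotopic or anti-isotopic.
   Context: A map $\alpha : V \times V \to W$ is a generalized nonsingular map if it is biadditive and $\alpha(v,V) = \alpha(V,v) = W$ for every $v \in V$ with $v \neq 0$, where $\alpha(v,V)=\{\alpha(v,u) : u\in V\}$ and $\alpha(V,v)=\{\alpha(u,v) : u \in V\}$. For such $\alpha$, the group $G(\alpha)$ is the set $V \times V \times W$ with multiplication $(a_1,b_1,c_1)(a_2,b_2,c_2) = (a_1+a_2,\, b_1+b_2,\, c_1+c_2+\alpha(a_1,b_2))$. Generalized nonsingular maps $\alpha_1,\alpha_2 : V\times V \to W$ are isotopic if there exist additive isomorphisms $a,b : V \to V$ and $c : W \to W$ with $\alpha_2(a(v_1),b(v_2)) = c(\alpha_1(v_1,v_2))$ for all $v_1,v_2\in V$; they are anti-isotopic if there exist additive isomorphisms $a,b : V \to V$ and $c : W \to W$ with $\alpha_2(b(v_2),a(v_1)) = c(\alpha_1(v_1,v_2))$ for all $v_1,v_2 \in V$. *)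

theory Defs
  imports Complex_Main "HOL-Algebra.Coset" "HOL-Computational_Algebra.Primes"
begin

text \<open>
  The groups \<open>V\<close> and \<open>W\<close> are HOL-Algebra groups, so their operation, written \<open>+\<close> in the
  mathematical text, is \<open>\<otimes>\<close> here, and \<open>0\<close> is \<open>\<one>\<close>; ``additive'' maps are homomorphisms.
  Maps \<open>V \<times> V \<rightarrow> W\<close> are curried and only their values on the carriers matter.
\<close>

definition elementary_abelian_group :: "nat \<Rightarrow> ('a, 'r) monoid_scheme \<Rightarrow> bool" where
  "elementary_abelian_group p G \<longleftrightarrow>
     prime p \<and> comm_group G \<and> (\<forall>x\<in>carrier G. x [^]\<^bsub>G\<^esub> p = \<one>\<^bsub>G\<^esub>)"

definition biadditive ::
  "('v, 'r) monoid_scheme \<Rightarrow> ('w, 's) monoid_scheme \<Rightarrow> ('v \<Rightarrow> 'v \<Rightarrow> 'w) \<Rightarrow> bool" where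
  "biadditive V W \<alpha> \<longleftrightarrow>
     (\<forall>v\<in>carrier V. (\<lambda>u. \<alpha> v u) \<in> hom V W) \<and>
     (\<forall>u\<in>carrier V. (\<lambda>v. \<alpha> v u) \<in> hom V W)"

definition generalized_nonsingular ::
  "('v, 'r) monoid_scheme \<Rightarrow> ('w, 's) monoid_scheme \<Rightarrow> ('v \<Rightarrow> 'v \<Rightarrow> 'w) \<Rightarrow> bool" where
  "generalized_nonsingular V W \<alpha> \<longleftrightarrow>
     biadditive V W \<alpha> \<and>
     (\<forall>v\<in>carrier V. v \<noteq> \<one>\<^bsub>V\<^esub> \<longrightarrow>
        (\<lambda>u. \<alpha> v u) ` carrier V = carrier W \<and>
        (\<lambda>u. \<alpha> u v) ` carrier V = carrier W)"

definition nonsingular_group ::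
  "('v, 'r) monoid_scheme \<Rightarrow> ('w, 's) monoid_scheme \<Rightarrow> ('v \<Rightarrow> 'v \<Rightarrow> 'w) \<Rightarrow> ('v \<times> 'v \<times> 'w) monoid"
where
  "nonsingular_group V W \<alpha> =
     \<lparr>carrier = carrier V \<times> carrier V \<times> carrier W,
      monoid.mult = (\<lambda>(a1, b1, c1) (a2, b2, c2).
        (a1 \<otimes>\<^bsub>V\<^esub> a2, b1 \<otimes>\<^bsub>V\<^esub> b2, c1 \<otimes>\<^bsub>W\<^esub> c2 \<otimes>\<^bsub>W\<^esub> \<alpha> a1 b2)),
      one = (\<one>\<^bsub>V\<^esub>, \<one>\<^bsub>V\<^esub>, \<one>\<^bsub>W\<^esub>)\<rparr>"

definition isotopic ::
  "('v, 'r) monoid_scheme \<Rightarrow> ('w, 's) monoid_scheme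
     \<Rightarrow> ('v \<Rightarrow> 'v \<Rightarrow> 'w) \<Rightarrow> ('v \<Rightarrow> 'v \<Rightarrow> 'w) \<Rightarrow> bool" where
  "isotopic V W \<alpha>1 \<alpha>2 \<longleftrightarrow>
     (\<exists>a\<in>iso V V. \<exists>b\<in>iso V V. \<exists>c\<in>iso W W.
        \<forall>v1\<in>carrier V. \<forall>v2\<in>carrier V. \<alpha>2 (a v1) (b v2) = c (\<alpha>1 v1 v2))"

definition anti_isotopic ::
  "('v, 'r) monoid_scheme \<Rightarrow> ('w, 's) monoid_scheme
     \<Rightarrow> ('v \<Rightarrow> 'v \<Rightarrow> 'w) \<Rightarrow> ('v \<Rightarrow> 'v \<Rightarrow> 'w) \<Rightarrow> bool" where
  "anti_isotopic V W \<alpha>1 \<alpha>2 \<longleftrightarrow>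
     (\<exists>a\<in>iso V V. \<exists>b\<in>iso V V. \<exists>c\<in>iso W W.
        \<forall>v1\<in>carrier V. \<forall>v2\<in>carrier V. \<alpha>2 (b v2) (a v1) = c (\<alpha>1 v1 v2))"

lemma group_nonsingular_group:
  assumes V: "comm_group V" and W: "comm_group W" and bi: "biadditive V W \<alpha>"
  shows "group (nonsingular_group V W \<alpha>)"
proof -
  interpret V: comm_group V by (rule V)
  interpret W: comm_group W by (rule W)
  have closed [simp]: "\<alpha> x y \<in> carrier W" if "x \<in> carrier V" "y \<in> carrier V" for x y
    using bi that unfolding biadditive_def by (auto simp: hom_def)
  have add_right: "\<alpha> x (y \<otimes>\<^bsub>V\<^esub> z) = \<alpha> x y \<otimes>\<^bsub>W\<^esub> \<alpha> x z"
    if "x \<in> carrier V" "y \<in> carrier V" "z \<in> carrier V" for x y z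
    using bi that unfolding biadditive_def by (auto simp: hom_def)
  have add_left: "\<alpha> (x \<otimes>\<^bsub>V\<^esub> y) z = \<alpha> x z \<otimes>\<^bsub>W\<^esub> \<alpha> y z"
    if "x \<in> carrier V" "y \<in> carrier V" "z \<in> carrier V" for x y z
    using bi that unfolding biadditive_def by (auto simp: hom_def)
  have one_left: "\<alpha> \<one>\<^bsub>V\<^esub> z = \<one>\<^bsub>W\<^esub>" if "z \<in> carrier V" for z
    using add_left[of "\<one>\<^bsub>V\<^esub>" "\<one>\<^bsub>V\<^esub>" z] that by simp
  show ?thesis
  proof (rule groupI)
    fix x assume x: "x \<in> carrier (nonsingular_group V W \<alpha>)"
    then obtain a b c where abc: "x = (a, b, c)" "a \<in> carrier V" "b \<in> carrier V" "c \<in> carrier W"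
      by (auto simp: nonsingular_group_def)
    let ?d = "inv\<^bsub>W\<^esub> (c \<otimes>\<^bsub>W\<^esub> \<alpha> (inv\<^bsub>V\<^esub> a) b)"
    have "?d \<otimes>\<^bsub>W\<^esub> c \<otimes>\<^bsub>W\<^esub> \<alpha> (inv\<^bsub>V\<^esub> a) b = \<one>\<^bsub>W\<^esub>"
      using abc by (subst W.m_assoc) (auto intro!: W.l_inv)
    with abc show "\<exists>y\<in>carrier (nonsingular_group V W \<alpha>).
        y \<otimes>\<^bsub>nonsingular_group V W \<alpha>\<^esub> x = \<one>\<^bsub>nonsingular_group V W \<alpha>\<^esub>"
      by (intro bexI[of _ "(inv\<^bsub>V\<^esub> a, inv\<^bsub>V\<^esub> b, ?d)"]) (auto simp: nonsingular_group_def)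
  qed (auto simp: nonsingular_group_def V.m_assoc W.m_ac add_left add_right one_left)
qed

end

theory Submission
  imports Defs
begin

text \<open>
  An isomorphism \<open>\<psi> : G(\<alpha>\<^sub>1) \<rightarrow> G(\<alpha>\<^sub>2)\<close> preserves the center \<open>W\<close> and hence the commutator form.
  Let \<open>s = (s\<^sub>1, s\<^sub>2)\<close> and \<open>t = (t\<^sub>1, t\<^sub>2)\<close> be the maps \<open>V \<rightarrow> V \<times> V\<close> induced by \<open>\<psi>\<close> modulo the center
  on the two coordinate copies of \<open>V\<close>, and let \<open>c\<close> be the restriction of \<open>\<psi>\<close> to the center. Then
  \<open>c (\<alpha>\<^sub>1(x, y)) = \<alpha>\<^sub>2(s\<^sub>1 x, t\<^sub>2 y) - \<alpha>\<^sub>2(t\<^sub>1 y, s\<^sub>2 x)\<close>, and the image of \<open>s\<close> is isotropic, i.e.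
  \<open>\<alpha>\<^sub>2(s\<^sub>1 x, s\<^sub>2 x') = \<alpha>\<^sub>2(s\<^sub>1 x', s\<^sub>2 x)\<close>. Counting kernels, where \<open>2m > n\<close> enters, isotropy forces
  \<open>s\<^sub>1\<close> to be bijective or zero. If \<open>s\<^sub>1\<close> is bijective, isotropy rewrites the commutator form as
  \<open>\<alpha>\<^sub>2(s\<^sub>1 x, h y)\<close> with \<open>h = t\<^sub>2 - s\<^sub>2 s\<^sub>1\<^sup>-\<^sup>1 t\<^sub>1\<close>, which is an isotopism; if \<open>s\<^sub>1\<close> is zero, what remains
  is \<open>- \<alpha>\<^sub>2(t\<^sub>1 y, s\<^sub>2 x)\<close>, an anti-isotopism.
\<close>

section \<open>Homomorphisms of finite and of commutative groups\<close>

lemma (in group_hom) card_kernel_times_card_image: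
  "card (kernel G H h) * card (h ` carrier G) = order G"
proof -
  \<comment> \<open>The codomain is cut down to the image to make \<open>h\<close> surjective; the
    first isomorphism theorem then matches cosets of the kernel with image elements.\<close>
  let ?I = "H\<lparr>carrier := h ` carrier G\<rparr>"
  have "subgroup (h ` carrier G) H"
    by (rule img_is_subgroup)
  then interpret I: group_hom G ?I h
    using H.subgroup_imp_group homh
    by (intro group_hom.intro group_hom_axioms.intro G.group_axioms) (auto simp: hom_def)
  have ker: "kernel G ?I h = kernel G H h"
    by (simp add: kernel_def)
  have "bij_betw (\<lambda>X. the_elem (h ` X)) (rcosets (kernel G H h)) (h ` carrier G)"
    using I.FactGroup_iso_set unfolding ker by (simp add: iso_def FactGroup_def)
  with G.lagrange[OF subgroup_kernel] show ?thesis
    by (simp add: bij_betw_same_card mult.commute)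
qed

lemma (in group) inj_endomorphism_imp_iso:
  assumes "finite (carrier G)" "h \<in> hom G G" "\<And>x. x \<in> carrier G \<Longrightarrow> h x = \<one> \<Longrightarrow> x = \<one>"
  shows "h \<in> iso G G"
proof -
  have "inj_on h (carrier G)"
    using assms inj_on_one_iff' group_axioms by blast
  moreover have "h ` carrier G \<subseteq> carrier G"
    using assms by (auto simp: hom_def)
  ultimately show ?thesis
    using assms by (simp add: iso_iff endo_inj_surj)
qed

lemma (in comm_group) hom_mult_inverse:
  assumes "f \<in> hom H G" "g \<in> hom H G"
  shows "(\<lambda>x. f x \<otimes> inv (g x)) \<in> hom H G"
proof (rule homI)
  fix x y assume "x \<in> carrier H" "y \<in> carrier H"
  moreover from this assms have "f x \<in> carrier G" "f y \<in> carrier G" "g x \<in> carrier G" "g y \<in> carrier G"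
    by (auto simp: hom_def)
  ultimately show "f (x \<otimes>\<^bsub>H\<^esub> y) \<otimes> inv g (x \<otimes>\<^bsub>H\<^esub> y) = f x \<otimes> inv g x \<otimes> (f y \<otimes> inv g y)"
    using assms by (simp add: hom_mult inv_mult m_ac)
qed (use assms in \<open>auto simp: hom_def Pi_iff\<close>)

section \<open>Biadditive maps and multiplication in their groups\<close>

locale biadditive_map = V: comm_group V + W: comm_group W
  for V :: "('v, 'r) monoid_scheme" and W :: "('w, 's) monoid_scheme" +
  fixes \<alpha> :: "'v \<Rightarrow> 'v \<Rightarrow> 'w"
  assumes biadditive: "biadditive V W \<alpha>"
begin

lemma hom_right: "v \<in> carrier V \<Longrightarrow> \<alpha> v \<in> hom V W"
  and hom_left: "u \<in> carrier V \<Longrightarrow> (\<lambda>v. \<alpha> v u) \<in> hom V W"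
  using biadditive by (auto simp: biadditive_def)

lemma closed [simp]: "x \<in> carrier V \<Longrightarrow> y \<in> carrier V \<Longrightarrow> \<alpha> x y \<in> carrier W"
  using hom_right by (auto simp: hom_def)

lemma add_right:
  "\<lbrakk>x \<in> carrier V; y \<in> carrier V; z \<in> carrier V\<rbrakk> \<Longrightarrow> \<alpha> x (y \<otimes>\<^bsub>V\<^esub> z) = \<alpha> x y \<otimes>\<^bsub>W\<^esub> \<alpha> x z"
  using hom_right by (auto simp: hom_def)

lemma add_left:
  "\<lbrakk>x \<in> carrier V; y \<in> carrier V; z \<in> carrier V\<rbrakk> \<Longrightarrow> \<alpha> (x \<otimes>\<^bsub>V\<^esub> y) z = \<alpha> x z \<otimes>\<^bsub>W\<^esub> \<alpha> y z"
  using hom_left by (auto simp: hom_def)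

lemma group_hom_right: "v \<in> carrier V \<Longrightarrow> group_hom V W (\<alpha> v)"
  and group_hom_left: "u \<in> carrier V \<Longrightarrow> group_hom V W (\<lambda>v. \<alpha> v u)"
  using hom_left hom_right
  by (auto intro!: group_hom.intro group_hom_axioms.intro V.group_axioms W.group_axioms)

lemma one_right [simp]: "x \<in> carrier V \<Longrightarrow> \<alpha> x \<one>\<^bsub>V\<^esub> = \<one>\<^bsub>W\<^esub>"
  and one_left [simp]: "x \<in> carrier V \<Longrightarrow> \<alpha> \<one>\<^bsub>V\<^esub> x = \<one>\<^bsub>W\<^esub>"
  using group_hom.hom_one[OF group_hom_right] group_hom.hom_one[OF group_hom_left] by auto

lemma inv_right:
  "\<lbrakk>x \<in> carrier V; y \<in> carrier V\<rbrakk> \<Longrightarrow> \<alpha> x (inv\<^bsub>V\<^esub> y) = inv\<^bsub>W\<^esub> \<alpha> x y"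
  using group_hom.hom_inv[OF group_hom_right] by auto

abbreviation G where "G \<equiv> nonsingular_group V W \<alpha>"

lemma carrier_G: "carrier G = carrier V \<times> carrier V \<times> carrier W"
  by (simp add: nonsingular_group_def)

lemma mult_G:
  "(a1, b1, c1) \<otimes>\<^bsub>G\<^esub> (a2, b2, c2) =
    (a1 \<otimes>\<^bsub>V\<^esub> a2, b1 \<otimes>\<^bsub>V\<^esub> b2, c1 \<otimes>\<^bsub>W\<^esub> c2 \<otimes>\<^bsub>W\<^esub> \<alpha> a1 b2)"
  by (simp add: nonsingular_group_def)

lemma one_G: "\<one>\<^bsub>G\<^esub> = (\<one>\<^bsub>V\<^esub>, \<one>\<^bsub>V\<^esub>, \<one>\<^bsub>W\<^esub>)"
  by (simp add: nonsingular_group_def)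

lemma group_G: "group G"
  by (rule group_nonsingular_group[OF V.comm_group_axioms W.comm_group_axioms biadditive])

text \<open>The two products differ only by \<alpha>(a1, b2) - \<alpha>(a2, b1), the value of the
  commutator form. Stating this as a criterion for commuting avoids computing inverses in
  \<open>G\<close>.\<close>

lemma commute_iff:
  assumes "a1 \<in> carrier V" "b1 \<in> carrier V" "c1 \<in> carrier W"
    and "a2 \<in> carrier V" "b2 \<in> carrier V" "c2 \<in> carrier W"
  shows "(a1, b1, c1) \<otimes>\<^bsub>G\<^esub> (a2, b2, c2) = (a2, b2, c2) \<otimes>\<^bsub>G\<^esub> (a1, b1, c1) \<longleftrightarrow> \<alpha> a1 b2 = \<alpha> a2 b1"
  using assms by (simp add: mult_G V.m_comm W.m_comm[of c1 c2])

end

section \<open>Nonsingular maps: center, annihilators and isotropic images\<close>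

locale nonsingular_map = biadditive_map +
  \<comment> \<open>\<open>W_nontrivial\<close> excludes the zero map into a trivial group, which
    satisfies the surjectivity conditions although it annihilates all of \<open>V\<close>.
    Nondegeneracy rests on it.\<close>
  assumes nonsingular: "generalized_nonsingular V W \<alpha>"
    and finite_V: "finite (carrier V)" and finite_W: "finite (carrier W)"
    and W_nontrivial: "order W \<noteq> 1"
begin

lemma surj_right: "v \<in> carrier V \<Longrightarrow> v \<noteq> \<one>\<^bsub>V\<^esub> \<Longrightarrow> \<alpha> v ` carrier V = carrier W"
  and surj_left: "v \<in> carrier V \<Longrightarrow> v \<noteq> \<one>\<^bsub>V\<^esub> \<Longrightarrow> (\<lambda>u. \<alpha> u v) ` carrier V = carrier W"
  using nonsingular by (auto simp: generalized_nonsingular_def)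

lemma carrier_W_neq: "carrier W \<noteq> {\<one>\<^bsub>W\<^esub>}"
  using W_nontrivial by (auto simp: order_def)

lemma nondegenerate_right:
  assumes "v \<in> carrier V" "\<And>u. u \<in> carrier V \<Longrightarrow> \<alpha> v u = \<one>\<^bsub>W\<^esub>"
  shows "v = \<one>\<^bsub>V\<^esub>"
proof (rule ccontr)
  assume "v \<noteq> \<one>\<^bsub>V\<^esub>"
  with assms surj_right[of v] have "carrier W \<subseteq> {\<one>\<^bsub>W\<^esub>}" by auto
  with carrier_W_neq show False by auto
qed

lemma nondegenerate_left:
  assumes "v \<in> carrier V" "\<And>u. u \<in> carrier V \<Longrightarrow> \<alpha> u v = \<one>\<^bsub>W\<^esub>"
  shows "v = \<one>\<^bsub>V\<^esub>"
proof (rule ccontr)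
  assume "v \<noteq> \<one>\<^bsub>V\<^esub>"
  with assms surj_left[of v] have "carrier W \<subseteq> {\<one>\<^bsub>W\<^esub>}" by auto
  with carrier_W_neq show False by auto
qed

text \<open>An element (a, b, w) is central when \<alpha>(a, y) = \<alpha>(x, b) for independent x
  and y. Setting either variable to zero makes both sides vanish, and nondegeneracy gives a = b =
  0.\<close>

lemma central_iff:
  assumes "z \<in> carrier G"
  shows "(\<forall>g\<in>carrier G. z \<otimes>\<^bsub>G\<^esub> g = g \<otimes>\<^bsub>G\<^esub> z) \<longleftrightarrow> (\<exists>w\<in>carrier W. z = (\<one>\<^bsub>V\<^esub>, \<one>\<^bsub>V\<^esub>, w))"
proof -
  obtain a b w where z: "z = (a, b, w)" "a \<in> carrier V" "b \<in> carrier V" "w \<in> carrier W"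
    using assms by (auto simp: carrier_G)
  have "(\<forall>g\<in>carrier G. z \<otimes>\<^bsub>G\<^esub> g = g \<otimes>\<^bsub>G\<^esub> z) \<longleftrightarrow>
      (\<forall>x\<in>carrier V. \<forall>y\<in>carrier V. \<alpha> a y = \<alpha> x b)"
    using z by (auto simp: carrier_G commute_iff)
  also have "\<dots> \<longleftrightarrow> a = \<one>\<^bsub>V\<^esub> \<and> b = \<one>\<^bsub>V\<^esub>"
  proof
    assume *: "\<forall>x\<in>carrier V. \<forall>y\<in>carrier V. \<alpha> a y = \<alpha> x b"
    have "\<alpha> a y = \<one>\<^bsub>W\<^esub>" if "y \<in> carrier V" for y
      using * that z one_left V.one_closed by metis
    moreover have "\<alpha> x b = \<one>\<^bsub>W\<^esub>" if "x \<in> carrier V" for x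
      using * that z one_right V.one_closed by metis
    ultimately show "a = \<one>\<^bsub>V\<^esub> \<and> b = \<one>\<^bsub>V\<^esub>"
      using nondegenerate_left nondegenerate_right z by blast
  qed auto
  finally show ?thesis
    using z by auto
qed

lemma card_annihilator_right:
  assumes "v \<in> carrier V" "v \<noteq> \<one>\<^bsub>V\<^esub>"
  shows "card {u \<in> carrier V. \<alpha> v u = \<one>\<^bsub>W\<^esub>} * order W = order V"
  using group_hom.card_kernel_times_card_image[OF group_hom_right[OF assms(1)]] surj_right[OF assms]
  by (simp add: kernel_def order_def)

lemma card_annihilator_left:
  assumes "v \<in> carrier V" "v \<noteq> \<one>\<^bsub>V\<^esub>"
  shows "card {u \<in> carrier V. \<alpha> u v = \<one>\<^bsub>W\<^esub>} * order W = order V"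
  using group_hom.card_kernel_times_card_image[OF group_hom_left[OF assms(1)]] surj_left[OF assms]
  by (simp add: kernel_def order_def)

text \<open>If \<open>s1\<close> is neither injective nor zero, its kernel K is squeezed. A nonzero
  element of K makes the image of \<open>s1\<close> small and so gives |K| \<ge> |W|; an element
  outside K gives |K| \<le> |V| / |W|. Together |W|^2 \<le> |V|, against
  \<open>large\<close>.\<close>

lemma isotropic_projection_iso_or_trivial:
  assumes large: "order V < order W * order W"
    and s1: "s1 \<in> hom V V" and s2: "s2 \<in> hom V V"
    and inj: "\<And>x. \<lbrakk>x \<in> carrier V; s1 x = \<one>\<^bsub>V\<^esub>; s2 x = \<one>\<^bsub>V\<^esub>\<rbrakk> \<Longrightarrow> x = \<one>\<^bsub>V\<^esub>"
    and isotropic: "\<And>x y. \<lbrakk>x \<in> carrier V; y \<in> carrier V\<rbrakk> \<Longrightarrow> \<alpha> (s1 x) (s2 y) = \<alpha> (s1 y) (s2 x)"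
  shows "s1 \<in> iso V V \<or> (\<forall>x\<in>carrier V. s1 x = \<one>\<^bsub>V\<^esub>)"
proof (rule ccontr)
  assume "\<not> ?thesis"
  then obtain a b where a: "a \<in> carrier V" "s1 a = \<one>\<^bsub>V\<^esub>" "a \<noteq> \<one>\<^bsub>V\<^esub>"
    and b: "b \<in> carrier V" "s1 b \<noteq> \<one>\<^bsub>V\<^esub>"
    using V.inj_endomorphism_imp_iso[OF finite_V s1] by blast
  interpret s1: group_hom V V s1
    by (intro group_hom.intro group_hom_axioms.intro V.group_axioms s1)
  interpret s2: group_hom V V s2
    by (intro group_hom.intro group_hom_axioms.intro V.group_axioms s2)
  define K where "K = kernel V V s1"
  have K: "x \<in> K \<longleftrightarrow> x \<in> carrier V \<and> s1 x = \<one>\<^bsub>V\<^esub>" for x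
    by (auto simp: K_def kernel_def)
  define A where "A = {u \<in> carrier V. \<alpha> u (s2 a) = \<one>\<^bsub>W\<^esub>}"
  define B where "B = {u \<in> carrier V. \<alpha> (s1 b) u = \<one>\<^bsub>W\<^esub>}"
  have A: "card A * order W = order V"
    unfolding A_def using a inj[of a] by (intro card_annihilator_left) auto
  have B: "card B * order W = order V"
    unfolding B_def using b by (intro card_annihilator_right) auto
  have pos: "order V > 0"
    using finite_V V.order_gt_0_iff_finite by simp
  \<comment> \<open>By isotropy \<alpha>(s1 u, s2 a) = \<alpha>(s1 a, s2 u) = 0. The size of
    \<open>A\<close> was available because \<open>inj\<close> makes s2 a nonzero.\<close>
  have "s1 ` carrier V \<subseteq> A"
    using a isotropic[of _ a] isotropic[of a] by (auto simp: A_def)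
  then have "card (s1 ` carrier V) \<le> card A"
    using finite_V by (intro card_mono) (auto simp: A_def)
  \<comment> \<open>Both |A| |W| and |K| |s1 V| equal |V|; afterwards the positive factor |A|
    cancels.\<close>
  then have "card A * order W \<le> card K * card A"
    using s1.card_kernel_times_card_image A by (metis K_def mult_le_mono2)
  moreover have "card A > 0"
    using A pos by (cases "card A = 0") auto
  ultimately have 1: "order W \<le> card K"
    by (simp add: mult.commute[of "card K"])
  have "inj_on s2 K"
  proof (rule inj_onI)
    fix x y assume xy: "x \<in> K" "y \<in> K" "s2 x = s2 y"
    have "x \<otimes>\<^bsub>V\<^esub> inv\<^bsub>V\<^esub> y = \<one>\<^bsub>V\<^esub>"
      by (rule inj) (use xy in \<open>auto simp: K\<close>)
    with xy show "x = y"
      using V.inv_solve_right'[of "\<one>\<^bsub>V\<^esub>" x y] by (auto simp: K)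
  qed
  \<comment> \<open>For x in K, isotropy gives \<alpha>(s1 b, s2 x) = \<alpha>(s1 x, s2 b) =
    0.\<close>
  moreover have "s2 ` K \<subseteq> B"
    using b isotropic[of b] by (auto simp: B_def K)
  ultimately have "card K \<le> card B"
    using finite_V by (intro card_inj_on_le) (auto simp: B_def)
  with 1 have "order W * order W \<le> card B * order W"
    by simp
  with B large show False
    by simp
qed

end

section \<open>Group isomorphisms from isotopisms and anti-isotopisms\<close>

lemma isotopic_imp_is_iso:
  assumes "biadditive_map V W \<alpha>1" "biadditive_map V W \<alpha>2" "isotopic V W \<alpha>1 \<alpha>2"
  shows "nonsingular_group V W \<alpha>1 \<cong> nonsingular_group V W \<alpha>2"
proof -
  interpret A1: biadditive_map V W \<alpha>1 by fact
  interpret A2: biadditive_map V W \<alpha>2 by fact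
  obtain a b c where iso: "a \<in> iso V V" "b \<in> iso V V" "c \<in> iso W W"
    and eq: "\<And>x y. \<lbrakk>x \<in> carrier V; y \<in> carrier V\<rbrakk> \<Longrightarrow> \<alpha>2 (a x) (b y) = c (\<alpha>1 x y)"
    using assms(3) by (auto simp: isotopic_def)
  note hom = iso[THEN iso_imp_homomorphism]
  note closed [simp] = hom[THEN hom_in_carrier]
  let ?f = "\<lambda>(x, y, z). (a x, b y, c z)"
  have "?f \<in> hom A1.G A2.G"
    using hom by (auto simp: hom_def A1.carrier_G A2.carrier_G A1.mult_G A2.mult_G Pi_iff eq)
  moreover have "bij_betw ?f (carrier A1.G) (carrier A2.G)"
  proof -
    have "?f = map_prod a (map_prod b c)" by auto
    then show ?thesis
      using iso by (auto simp: A1.carrier_G A2.carrier_G iso_def intro!: bij_betw_map_prod)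
  qed
  ultimately show ?thesis
    by (intro is_isoI isoI)
qed

text \<open>The map (x, y, z) \<mapsto> (y, x, -z + \<alpha>1(x, y)) is an isomorphism from
  G(\<alpha>1) to the group of the transposed map (u, v) \<mapsto> \<alpha>1(v, u). An
  anti-isotopism is an isotopism from that transpose to \<alpha>2, so \<open>?f\<close> composes the
  two.\<close>

lemma anti_isotopic_imp_is_iso:
  assumes "biadditive_map V W \<alpha>1" "biadditive_map V W \<alpha>2" "anti_isotopic V W \<alpha>1 \<alpha>2"
  shows "nonsingular_group V W \<alpha>1 \<cong> nonsingular_group V W \<alpha>2"
proof -
  interpret A1: biadditive_map V W \<alpha>1 by fact
  interpret A2: biadditive_map V W \<alpha>2 by fact
  obtain a b c where iso: "a \<in> iso V V" "b \<in> iso V V" "c \<in> iso W W"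
    and eq: "\<And>x y. \<lbrakk>x \<in> carrier V; y \<in> carrier V\<rbrakk> \<Longrightarrow> \<alpha>2 (b y) (a x) = c (\<alpha>1 x y)"
    using assms(3) by (auto simp: anti_isotopic_def)
  note hom = iso[THEN iso_imp_homomorphism]
  note closed [simp] = hom[THEN hom_in_carrier]
  let ?t = "\<lambda>(x, y, z). (x, y, inv\<^bsub>W\<^esub> z \<otimes>\<^bsub>W\<^esub> \<alpha>1 x y)"
  let ?f = "\<lambda>(x, y, z). (b y, a x, c (inv\<^bsub>W\<^esub> z \<otimes>\<^bsub>W\<^esub> \<alpha>1 x y))"
  have "?f \<in> hom A1.G A2.G"
  proof (rule homI)
    fix g h assume "g \<in> carrier A1.G" "h \<in> carrier A1.G"
    then obtain x1 y1 z1 x2 y2 z2 where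
      gh: "g = (x1, y1, z1)" "x1 \<in> carrier V" "y1 \<in> carrier V" "z1 \<in> carrier W"
          "h = (x2, y2, z2)" "x2 \<in> carrier V" "y2 \<in> carrier V" "z2 \<in> carrier W"
      by (auto simp: A1.carrier_G)
    let ?z = "inv\<^bsub>W\<^esub> (z1 \<otimes>\<^bsub>W\<^esub> z2 \<otimes>\<^bsub>W\<^esub> \<alpha>1 x1 y2) \<otimes>\<^bsub>W\<^esub> \<alpha>1 (x1 \<otimes>\<^bsub>V\<^esub> x2) (y1 \<otimes>\<^bsub>V\<^esub> y2)"
    \<comment> \<open>Negating the third coordinate produces -\<alpha>1(x1, y2), which cancels one
      cross term of \<alpha>1(x1 + x2, y1 + y2) and leaves the transposed one, \<alpha>1(x2,
      y1).\<close>
    have "\<alpha>1 x1 y2 \<otimes>\<^bsub>W\<^esub> (\<alpha>1 x2 y1 \<otimes>\<^bsub>W\<^esub> (\<alpha>1 x2 y2 \<otimes>\<^bsub>W\<^esub> inv\<^bsub>W\<^esub> \<alpha>1 x1 y2)) = \<alpha>1 x2 y1 \<otimes>\<^bsub>W\<^esub> \<alpha>1 x2 y2"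
      using gh by (simp add: A1.W.m_lcomm[of "\<alpha>1 x1 y2"])
    then have "?z = (inv\<^bsub>W\<^esub> z1 \<otimes>\<^bsub>W\<^esub> \<alpha>1 x1 y1) \<otimes>\<^bsub>W\<^esub> (inv\<^bsub>W\<^esub> z2 \<otimes>\<^bsub>W\<^esub> \<alpha>1 x2 y2) \<otimes>\<^bsub>W\<^esub> \<alpha>1 x2 y1"
      using gh by (simp add: A1.add_left A1.add_right A1.W.inv_mult A1.W.m_ac)
    then have "c ?z = c (inv\<^bsub>W\<^esub> z1 \<otimes>\<^bsub>W\<^esub> \<alpha>1 x1 y1) \<otimes>\<^bsub>W\<^esub> c (inv\<^bsub>W\<^esub> z2 \<otimes>\<^bsub>W\<^esub> \<alpha>1 x2 y2) \<otimes>\<^bsub>W\<^esub> c (\<alpha>1 x2 y1)"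
      using gh by (simp add: hom_mult[OF hom(3)])
    then show "?f (g \<otimes>\<^bsub>A1.G\<^esub> h) = ?f g \<otimes>\<^bsub>A2.G\<^esub> ?f h"
      using gh hom by (simp add: A1.mult_G A2.mult_G eq hom_mult)
  qed (auto simp: A1.carrier_G A2.carrier_G)
  moreover have "bij_betw ?f (carrier A1.G) (carrier A2.G)"
  proof -
    \<comment> \<open>\<open>?t\<close> is an involution, hence its own witness: -(-z + \<alpha>1(x,
      y)) + \<alpha>1(x, y) = z.\<close>
    have t: "bij_betw ?t (carrier A1.G) (carrier A1.G)"
    proof (rule bij_betw_byWitness[where f' = ?t])
      show "\<forall>g\<in>carrier A1.G. ?t (?t g) = g" "\<forall>g\<in>carrier A1.G. ?t (?t g) = g"
        by (auto simp: A1.carrier_G A1.W.inv_mult A1.W.m_assoc)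
    qed (auto simp: A1.carrier_G)
    have abc: "bij_betw (map_prod a (map_prod b c)) (carrier A1.G) (carrier A1.G)"
      using iso by (auto simp: A1.carrier_G iso_def intro!: bij_betw_map_prod)
    have swap: "bij_betw (\<lambda>(x, y, z). (y, x, z)) (carrier A1.G) (carrier A2.G)"
      by (rule bij_betw_byWitness[where f' = "\<lambda>(x, y, z). (y, x, z)"])
        (auto simp: A1.carrier_G A2.carrier_G)
    have "?f = (\<lambda>(x, y, z). (y, x, z)) \<circ> (map_prod a (map_prod b c) \<circ> ?t)"
      by auto
    then show ?thesis
      using bij_betw_trans[OF bij_betw_trans[OF t abc] swap] by (simp only:)
  qed
  ultimately show ?thesis
    by (intro is_isoI isoI)
qed

section \<open>Isotopisms and anti-isotopisms from a group isomorphism\<close>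

lemma is_iso_imp_isotopic_or_anti_isotopic:
  assumes "nonsingular_map V W \<alpha>1" "nonsingular_map V W \<alpha>2"
    and large: "order V < order W * order W"
    and "nonsingular_group V W \<alpha>1 \<cong> nonsingular_group V W \<alpha>2"
  shows "isotopic V W \<alpha>1 \<alpha>2 \<or> anti_isotopic V W \<alpha>1 \<alpha>2"
proof -
  interpret A1: nonsingular_map V W \<alpha>1 by fact
  interpret A2: nonsingular_map V W \<alpha>2 by fact
  interpret G1: group A1.G by (rule A1.group_G)
  interpret G2: group A2.G by (rule A2.group_G)
  note [simp] = A1.carrier_G A2.carrier_G
  obtain \<psi> where \<psi>: "\<psi> \<in> iso A1.G A2.G"
    using assms(4) by (auto simp: is_iso_def)
  interpret \<psi>: group_hom A1.G A2.G \<psi>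
    using \<psi> by unfold_locales (rule iso_imp_homomorphism)
  have \<psi>_inj: "inj_on \<psi> (carrier A1.G)" and \<psi>_surj: "\<psi> ` carrier A1.G = carrier A2.G"
    using \<psi> by (auto simp: iso_iff)
  \<comment> \<open>The maps \<open>s3\<close> and \<open>t3\<close> are not claimed to be additive;
    they cancel in \<open>form\<close>.\<close>
  define s1 s2 s3 where "s1 x = fst (\<psi> (x, \<one>\<^bsub>V\<^esub>, \<one>\<^bsub>W\<^esub>))"
    and "s2 x = fst (snd (\<psi> (x, \<one>\<^bsub>V\<^esub>, \<one>\<^bsub>W\<^esub>)))"
    and "s3 x = snd (snd (\<psi> (x, \<one>\<^bsub>V\<^esub>, \<one>\<^bsub>W\<^esub>)))" for x
  define t1 t2 t3 where "t1 y = fst (\<psi> (\<one>\<^bsub>V\<^esub>, y, \<one>\<^bsub>W\<^esub>))"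
    and "t2 y = fst (snd (\<psi> (\<one>\<^bsub>V\<^esub>, y, \<one>\<^bsub>W\<^esub>)))"
    and "t3 y = snd (snd (\<psi> (\<one>\<^bsub>V\<^esub>, y, \<one>\<^bsub>W\<^esub>)))" for y
  define c where "c z = snd (snd (\<psi> (\<one>\<^bsub>V\<^esub>, \<one>\<^bsub>V\<^esub>, z)))" for z
  have s: "\<psi> (x, \<one>\<^bsub>V\<^esub>, \<one>\<^bsub>W\<^esub>) = (s1 x, s2 x, s3 x)" for x
    by (simp add: s1_def s2_def s3_def)
  have t: "\<psi> (\<one>\<^bsub>V\<^esub>, y, \<one>\<^bsub>W\<^esub>) = (t1 y, t2 y, t3 y)" for y
    by (simp add: t1_def t2_def t3_def)
  have s_closed [simp]: "s1 x \<in> carrier V" "s2 x \<in> carrier V" "s3 x \<in> carrier W"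
    if "x \<in> carrier V" for x
    using \<psi>.hom_closed[of "(x, \<one>\<^bsub>V\<^esub>, \<one>\<^bsub>W\<^esub>)"] that by (auto simp: s)
  have t_closed [simp]: "t1 y \<in> carrier V" "t2 y \<in> carrier V" "t3 y \<in> carrier W"
    if "y \<in> carrier V" for y
    using \<psi>.hom_closed[of "(\<one>\<^bsub>V\<^esub>, y, \<one>\<^bsub>W\<^esub>)"] that by (auto simp: t)
  have c: "\<psi> (\<one>\<^bsub>V\<^esub>, \<one>\<^bsub>V\<^esub>, z) = (\<one>\<^bsub>V\<^esub>, \<one>\<^bsub>V\<^esub>, c z)" and c_closed [simp]: "c z \<in> carrier W"
    if "z \<in> carrier W" for z
  proof -
    let ?z = "(\<one>\<^bsub>V\<^esub>, \<one>\<^bsub>V\<^esub>, z)"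
    have z: "?z \<in> carrier A1.G"
      using that by simp
    \<comment> \<open>Surjectivity of \<psi> carries central elements to central ones, so
      \<open>central_iff\<close> applies on both sides.\<close>
    have "\<psi> ?z \<otimes>\<^bsub>A2.G\<^esub> g = g \<otimes>\<^bsub>A2.G\<^esub> \<psi> ?z" if g: "g \<in> carrier A2.G" for g
    proof -
      obtain g' where g': "g = \<psi> g'" "g' \<in> carrier A1.G"
        using g \<psi>_surj by blast
      have "?z \<otimes>\<^bsub>A1.G\<^esub> g' = g' \<otimes>\<^bsub>A1.G\<^esub> ?z"
        using A1.central_iff[OF z] g'(2) \<open>z \<in> carrier W\<close> by blast
      then show ?thesis
        using z g' by (metis \<psi>.hom_mult)
    qed
    then have "\<exists>w\<in>carrier W. \<psi> ?z = (\<one>\<^bsub>V\<^esub>, \<one>\<^bsub>V\<^esub>, w)"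
      using A2.central_iff[OF \<psi>.hom_closed[OF z]] by blast
    then show "\<psi> ?z = (\<one>\<^bsub>V\<^esub>, \<one>\<^bsub>V\<^esub>, c z)" "c z \<in> carrier W"
      by (auto simp: c_def)
  qed
  have s_hom: "s1 \<in> hom V V" "s2 \<in> hom V V"
    using \<psi>.hom_mult[of "(x, \<one>\<^bsub>V\<^esub>, \<one>\<^bsub>W\<^esub>)" "(y, \<one>\<^bsub>V\<^esub>, \<one>\<^bsub>W\<^esub>)" for x y]
    by (auto simp: hom_def A1.mult_G A2.mult_G s)
  have t_hom: "t1 \<in> hom V V" "t2 \<in> hom V V"
    using \<psi>.hom_mult[of "(\<one>\<^bsub>V\<^esub>, x, \<one>\<^bsub>W\<^esub>)" "(\<one>\<^bsub>V\<^esub>, y, \<one>\<^bsub>W\<^esub>)" for x y]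
    by (auto simp: hom_def A1.mult_G A2.mult_G t)
  have c_hom: "c \<in> hom W W"
    using \<psi>.hom_mult[of "(\<one>\<^bsub>V\<^esub>, \<one>\<^bsub>V\<^esub>, x)" "(\<one>\<^bsub>V\<^esub>, \<one>\<^bsub>V\<^esub>, y)" for x y]
    by (auto simp: hom_def A1.mult_G A2.mult_G c)
  have c_inj: "z = \<one>\<^bsub>W\<^esub>" if "z \<in> carrier W" "c z = \<one>\<^bsub>W\<^esub>" for z
    using that \<psi>.inj_on_one_iff \<psi>_inj c[OF that(1)] by (auto simp: A1.one_G A2.one_G)
  have c_iso: "c \<in> iso W W"
    by (rule A1.W.inj_endomorphism_imp_iso[OF A1.finite_W c_hom c_inj])
  \<comment> \<open>Elements (x, 0, 0) commute with one another, hence so do their images.\<close>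
  have isotropic: "\<alpha>2 (s1 x) (s2 y) = \<alpha>2 (s1 y) (s2 x)" if "x \<in> carrier V" "y \<in> carrier V" for x y
  proof -
    let ?x = "(x, \<one>\<^bsub>V\<^esub>, \<one>\<^bsub>W\<^esub>)" and ?y = "(y, \<one>\<^bsub>V\<^esub>, \<one>\<^bsub>W\<^esub>)"
    have "?x \<otimes>\<^bsub>A1.G\<^esub> ?y = ?y \<otimes>\<^bsub>A1.G\<^esub> ?x"
      using that by (simp add: A1.commute_iff)
    then have "\<psi> ?x \<otimes>\<^bsub>A2.G\<^esub> \<psi> ?y = \<psi> ?y \<otimes>\<^bsub>A2.G\<^esub> \<psi> ?x"
      using that \<psi>.hom_mult[of ?x ?y] \<psi>.hom_mult[of ?y ?x] by simp
    then show ?thesis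
      using that by (simp add: s A2.commute_iff)
  qed
  have form: "\<alpha>2 (s1 x) (t2 y) = \<alpha>2 (t1 y) (s2 x) \<otimes>\<^bsub>W\<^esub> c (\<alpha>1 x y)"
    if "x \<in> carrier V" "y \<in> carrier V" for x y
  proof -
    let ?x = "(x, \<one>\<^bsub>V\<^esub>, \<one>\<^bsub>W\<^esub>)" and ?y = "(\<one>\<^bsub>V\<^esub>, y, \<one>\<^bsub>W\<^esub>)" and ?z = "(\<one>\<^bsub>V\<^esub>, \<one>\<^bsub>V\<^esub>, \<alpha>1 x y)"
    \<comment> \<open>This is the commutator relation without inverses; \<open>form\<close> is the
      third coordinate of its image under \<psi>.\<close>
    have "?x \<otimes>\<^bsub>A1.G\<^esub> ?y = (?y \<otimes>\<^bsub>A1.G\<^esub> ?x) \<otimes>\<^bsub>A1.G\<^esub> ?z"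
      using that by (simp add: A1.mult_G)
    moreover have "?x \<in> carrier A1.G" "?y \<in> carrier A1.G" "?z \<in> carrier A1.G"
      using that by auto
    ultimately have "\<psi> ?x \<otimes>\<^bsub>A2.G\<^esub> \<psi> ?y = (\<psi> ?y \<otimes>\<^bsub>A2.G\<^esub> \<psi> ?x) \<otimes>\<^bsub>A2.G\<^esub> \<psi> ?z"
      by (metis \<psi>.hom_mult G1.m_closed)
    then have "s3 x \<otimes>\<^bsub>W\<^esub> t3 y \<otimes>\<^bsub>W\<^esub> \<alpha>2 (s1 x) (t2 y) =
        t3 y \<otimes>\<^bsub>W\<^esub> s3 x \<otimes>\<^bsub>W\<^esub> \<alpha>2 (t1 y) (s2 x) \<otimes>\<^bsub>W\<^esub> c (\<alpha>1 x y)"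
      using that by (simp add: s t c A2.mult_G)
    also have "\<dots> = s3 x \<otimes>\<^bsub>W\<^esub> t3 y \<otimes>\<^bsub>W\<^esub> (\<alpha>2 (t1 y) (s2 x) \<otimes>\<^bsub>W\<^esub> c (\<alpha>1 x y))"
      using that by (simp add: A1.W.m_ac)
    finally show ?thesis
      using that by (simp add: A1.W.m_ac)
  qed
  \<comment> \<open>Both \<alpha>2 terms of \<open>form\<close> vanish for such x, so c(\<alpha>1(x,
    y)) = 0 for every y.\<close>
  have s_inj: "x = \<one>\<^bsub>V\<^esub>" if "x \<in> carrier V" "s1 x = \<one>\<^bsub>V\<^esub>" "s2 x = \<one>\<^bsub>V\<^esub>" for x
  proof (rule A1.nondegenerate_right[OF that(1)])
    fix y assume y: "y \<in> carrier V"
    have "c (\<alpha>1 x y) = \<one>\<^bsub>W\<^esub>"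
      using form[OF that(1) y] that y by simp
    then show "\<alpha>1 x y = \<one>\<^bsub>W\<^esub>"
      by (rule c_inj[rotated]) (use that y in simp)
  qed
  show ?thesis
    using A2.isotropic_projection_iso_or_trivial[OF large s_hom s_inj isotropic]
  proof
    assume s1_iso: "s1 \<in> iso V V"
    \<comment> \<open>With x' the preimage of t1 y under \<open>s1\<close>, isotropy turns
      \<alpha>2(t1 y, s2 x) = \<alpha>2(s1 x', s2 x) into \<alpha>2(s1 x, s2 x') = \<alpha>2(s1 x, r
      y). Both \<alpha>2 terms of \<open>form\<close> then share the first argument s1 x and merge
      into \<alpha>2(s1 x, h y).\<close>
    define r where "r = s2 \<circ> inv_into (carrier V) s1 \<circ> t1"
    have s1_inv: "inv_into (carrier V) s1 \<in> hom V V"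
      using s1_iso A1.V.iso_set_sym iso_imp_homomorphism by blast
    have s1_s1_inv: "s1 (inv_into (carrier V) s1 x) = x" if "x \<in> carrier V" for x
      using s1_iso that by (auto simp: iso_iff intro!: f_inv_into_f)
    have r_hom: "r \<in> hom V V"
      unfolding r_def using s_hom t_hom s1_inv by (intro hom_compose)
    define h where "h y = t2 y \<otimes>\<^bsub>V\<^esub> inv\<^bsub>V\<^esub> r y" for y
    have h_hom: "h \<in> hom V V"
      unfolding h_def by (intro A1.V.hom_mult_inverse t_hom r_hom)
    have h: "\<alpha>2 (s1 x) (h y) = c (\<alpha>1 x y)" if xy: "x \<in> carrier V" "y \<in> carrier V" for x y
    proof -
      let ?x' = "inv_into (carrier V) s1 (t1 y)"
      have x': "?x' \<in> carrier V"
        using xy s1_inv hom_in_carrier t_closed(1) by metis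
      have r: "r y \<in> carrier V"
        using r_hom hom_in_carrier xy by metis
      have "\<alpha>2 (t1 y) (s2 x) = \<alpha>2 (s1 ?x') (s2 x)"
        using xy by (simp add: s1_s1_inv)
      also have "\<dots> = \<alpha>2 (s1 x) (r y)"
        using isotropic[OF x' xy(1)] by (simp add: r_def)
      finally have "\<alpha>2 (s1 x) (t2 y) = \<alpha>2 (s1 x) (r y) \<otimes>\<^bsub>W\<^esub> c (\<alpha>1 x y)"
        using form[OF xy] by simp
      then show ?thesis
        using xy r
        by (simp add: h_def A2.add_right A2.inv_right A1.W.m_assoc
            A1.W.m_lcomm[of "\<alpha>2 (s1 x) (r y)"])
    qed
    have "h \<in> iso V V"
    proof (rule A1.V.inj_endomorphism_imp_iso[OF A1.finite_V h_hom])
      fix y assume y: "y \<in> carrier V" "h y = \<one>\<^bsub>V\<^esub>"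
      show "y = \<one>\<^bsub>V\<^esub>"
      proof (rule A1.nondegenerate_left[OF y(1)])
        fix x assume x: "x \<in> carrier V"
        then have "c (\<alpha>1 x y) = \<one>\<^bsub>W\<^esub>"
          using h[of x y] y by simp
        then show "\<alpha>1 x y = \<one>\<^bsub>W\<^esub>"
          by (rule c_inj[rotated]) (use x y in simp)
      qed
    qed
    with s1_iso c_iso h have "isotopic V W \<alpha>1 \<alpha>2"
      unfolding isotopic_def by blast
    then show ?thesis ..
  next
    assume s1_trivial: "\<forall>x\<in>carrier V. s1 x = \<one>\<^bsub>V\<^esub>"
    \<comment> \<open>The left side of \<open>form\<close> is now zero. The anti-isotopism therefore
      consists of \<open>s2\<close>, \<open>t1\<close> and the negative of \<open>c\<close>.\<close>
    have inv_form: "\<alpha>2 (t1 y) (s2 x) = inv\<^bsub>W\<^esub> c (\<alpha>1 x y)" if "x \<in> carrier V" "y \<in> carrier V" for x y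
      using form[OF that] s1_trivial that by (intro A1.W.inv_equality[symmetric]) auto
    have "s2 \<in> iso V V"
      by (rule A1.V.inj_endomorphism_imp_iso[OF A1.finite_V s_hom(2)]) (rule s_inj, use s1_trivial in simp_all)
    moreover have "t1 \<in> iso V V"
    proof (rule A1.V.inj_endomorphism_imp_iso[OF A1.finite_V t_hom(1)])
      fix y assume y: "y \<in> carrier V" "t1 y = \<one>\<^bsub>V\<^esub>"
      show "y = \<one>\<^bsub>V\<^esub>"
      proof (rule A1.nondegenerate_left[OF y(1)])
        fix x assume x: "x \<in> carrier V"
        then have "c (\<alpha>1 x y) = \<one>\<^bsub>W\<^esub>"
          using form[of x y] s1_trivial y by simp
        then show "\<alpha>1 x y = \<one>\<^bsub>W\<^esub>"
          by (rule c_inj[rotated]) (use x y in simp)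
      qed
    qed
    moreover have "(\<lambda>z. inv\<^bsub>W\<^esub> c z) \<in> iso W W"
    proof (rule A1.W.inj_endomorphism_imp_iso[OF A1.finite_W])
      show "(\<lambda>z. inv\<^bsub>W\<^esub> c z) \<in> hom W W"
        using c_hom by (auto simp: hom_def A1.W.inv_mult)
    next
      fix z assume z: "z \<in> carrier W" "inv\<^bsub>W\<^esub> c z = \<one>\<^bsub>W\<^esub>"
      then have "c z = \<one>\<^bsub>W\<^esub>"
        by simp
      then show "z = \<one>\<^bsub>W\<^esub>"
        by (rule c_inj[OF z(1)])
    qed
    ultimately have "anti_isotopic V W \<alpha>1 \<alpha>2"
      unfolding anti_isotopic_def using inv_form by (intro bexI ballI)
    then show ?thesis ..
  qed
qed

theorem theorem1p5:
  fixes p n m :: nat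
    and V :: "('v, 'r) monoid_scheme" and W :: "('w, 's) monoid_scheme"
    and \<alpha>1 \<alpha>2 :: "'v \<Rightarrow> 'v \<Rightarrow> 'w"
  assumes "prime p" and "n > 0" and "m > 0" and "real m > real n / 2"
    and "elementary_abelian_group p V" and "order V = p ^ n"
    and "elementary_abelian_group p W" and "order W = p ^ m"
    and "generalized_nonsingular V W \<alpha>1" and "generalized_nonsingular V W \<alpha>2"
  shows "nonsingular_group V W \<alpha>1 \<cong> nonsingular_group V W \<alpha>2 \<longleftrightarrow>
    isotopic V W \<alpha>1 \<alpha>2 \<or> anti_isotopic V W \<alpha>1 \<alpha>2"
proof -
  have V: "comm_group V" and W: "comm_group W"
    using assms by (auto simp: elementary_abelian_group_def)
  have p: "p > 1"
    using \<open>prime p\<close> by (rule prime_gt_1_nat)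
  have "order V > 0" "order W > 0"
    using assms p by auto
  then have finite: "finite (carrier V)" "finite (carrier W)"
    by (auto simp: order_def card_gt_0_iff)
  \<comment> \<open>The real inequality m > n/2 becomes |V| < |W|^2, the form used for
    counting.\<close>
  have "n < m + m"
    using \<open>real m > real n / 2\<close> by linarith
  then have large: "order V < order W * order W"
    using assms p by (simp flip: power_add)
  \<comment> \<open>Here m > 0 enters.\<close>
  have "order W \<noteq> 1"
    using assms p by simp
  then have map: "nonsingular_map V W \<alpha>" if "generalized_nonsingular V W \<alpha>" for \<alpha>
    using V W finite that
    by (simp add: nonsingular_map_def nonsingular_map_axioms_def biadditive_map_def
        biadditive_map_axioms_def generalized_nonsingular_def)
  note maps = map[OF assms(9)] map[OF assms(10)]
  note biadditive = maps[THEN nonsingular_map.axioms(1)]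
  show ?thesis
    using is_iso_imp_isotopic_or_anti_isotopic[OF maps large]
      isotopic_imp_is_iso[OF biadditive] anti_isotopic_imp_is_iso[OF biadditive]
    by metis
qed

end
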